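(* Let $\tau\in\mathbb{N}\cup\{0\}$, $\sigma\in\mathbb{Z}$, let $a,b,q:\mathbb{N}\to\mathbb{R}$ and $r:\mathbb{N}\to\mathbb{R}\setminus\{0\}$ be sequences, and let $f:\mathbb{R}\to\mathbb{R}$ be a function. Assume that: (i) $p\ge1$ is a real number; (ii) $f$ is locally Lipschitz; (iii) $\sum_{n=1}^{\infty}\left(\sum_{s=n}^{\infty}\left|\frac{1}{r_s}\right|\sum_{t=s}^{\infty}|a_t|\right)^p<+\infty$ and $\sum_{n=1}^{\infty}\left(\sum_{s=n}^{\infty}\left|\frac{1}{r_s}\right|\sum_{t=s}^{\infty}|b_t|\right)^p<+\infty$; (iv) $\sup_{n\in\mathbb{N}}|q_n|=q^\star\in(0,2^{1-p})$. Then the equation $$\Delta\left(r_n\Delta\left(x_n+q_nx_{n-\tau}\right)\right)=a_nf(x_{n-\sigma})+b_n$$ possesses an $l^p$-solution.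
   Context: $\mathbb{N}=\{1,2,3,\dots\}$, and $\Delta$ is the forward difference operator, $\Delta y_n=y_{n+1}-y_n$. Sums of nonnegative terms are understood in $[0,\infty]$. A solution of the equation is a real sequence $x=(x_n)_{n\ge 0}$ for which there is an integer $k\ge\max\{1,\tau,\sigma\}$ such that the equation holds for every integer $n\ge k$. It is an $l^p$-solution if moreover $x\in l^p$, i.e. $\sum_{n}|x_n|^p<\infty$. *)

theory Defs
  imports "HOL-Analysis.Analysis"
begin

definition forward_diff :: "(nat \<Rightarrow> real) \<Rightarrow> nat \<Rightarrow> real" ("\<Delta>") where
  "\<Delta> y n = y (Suc n) - y n"

definition locally_lipschitz :: "(real \<Rightarrow> real) \<Rightarrow> bool" where
  "locally_lipschitz f \<longleftrightarrow> (\<forall>x. \<exists>u>0. \<exists>L. L-lipschitz_on (cball x u) f)"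

text \<open>The library's notion is for families indexed by a metric parameter (time).\<close>

lemma locally_lipschitz_iff_local_lipschitz:
  "locally_lipschitz f \<longleftrightarrow> local_lipschitz (UNIV :: real set) UNIV (\<lambda>_. f)"
proof
  assume "locally_lipschitz f"
  then show "local_lipschitz (UNIV :: real set) UNIV (\<lambda>_. f)"
    unfolding locally_lipschitz_def local_lipschitz_def Int_UNIV_right by blast
next
  assume lip: "local_lipschitz (UNIV :: real set) UNIV (\<lambda>_. f)"
  show "locally_lipschitz f"
    unfolding locally_lipschitz_def
  proof
    fix x :: real
    obtain u L where "u > 0"
      and "\<forall>t \<in> cball (0::real) u \<inter> UNIV. L-lipschitz_on (cball x u \<inter> UNIV) f"
      using lip unfolding local_lipschitz_def by blast
    moreover have "(0::real) \<in> cball 0 u"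
      using \<open>u > 0\<close> by simp
    ultimately show "\<exists>u>0. \<exists>L. L-lipschitz_on (cball x u) f"
      using \<open>u > 0\<close> unfolding Int_UNIV_right by blast
  qed
qed

text \<open>Real powers on \<open>[0,\<infinity>]\<close>, meant for exponents \<open>p > 0\<close>.\<close>

definition ennreal_powr :: "ennreal \<Rightarrow> real \<Rightarrow> ennreal" where
  "ennreal_powr x p = (if x = \<infinity> then \<infinity> else ennreal (enn2real x powr p))"

definition iterated_tail_sum :: "real \<Rightarrow> (nat \<Rightarrow> real) \<Rightarrow> (nat \<Rightarrow> real) \<Rightarrow> ennreal" where
  "iterated_tail_sum p r c =
     (\<Sum>\<^sub>\<infinity>n\<in>{1..}. ennreal_powr
        (\<Sum>\<^sub>\<infinity>s\<in>{n..}. ennreal \<bar>1 / r s\<bar> * (\<Sum>\<^sub>\<infinity>t\<in>{s..}. ennreal \<bar>c t\<bar>)) p)"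

text \<open>
  The coefficient sequences are indexed by \<open>{1..}\<close>; their values at \<open>0\<close> are never used.
  Since \<open>n \<ge> k \<ge> max {1, \<tau>, \<sigma>}\<close>, neither the subtraction \<open>l - \<tau>\<close> (where \<open>l \<ge> n\<close>) nor the
  conversion \<open>nat (int n - \<sigma>)\<close> truncates.
\<close>

definition is_solution ::
  "nat \<Rightarrow> int \<Rightarrow> (nat \<Rightarrow> real) \<Rightarrow> (nat \<Rightarrow> real) \<Rightarrow> (nat \<Rightarrow> real) \<Rightarrow> (nat \<Rightarrow> real) \<Rightarrow>
   (real \<Rightarrow> real) \<Rightarrow> (nat \<Rightarrow> real) \<Rightarrow> bool" where
  "is_solution \<tau> \<sigma> a b q r f x \<longleftrightarrow>
     (\<exists>k::nat. int k \<ge> Max {1, int \<tau>, \<sigma>} \<and>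
       (\<forall>n\<ge>k. \<Delta> (\<lambda>m. r m * \<Delta> (\<lambda>l. x l + q l * x (l - \<tau>)) m) n
                 = a n * f (x (nat (int n - \<sigma>))) + b n))"

definition in_lp :: "real \<Rightarrow> (nat \<Rightarrow> real) \<Rightarrow> bool" where
  "in_lp p x \<longleftrightarrow> summable (\<lambda>n. \<bar>x n\<bar> powr p)"

definition is_lp_solution ::
  "real \<Rightarrow> nat \<Rightarrow> int \<Rightarrow> (nat \<Rightarrow> real) \<Rightarrow> (nat \<Rightarrow> real) \<Rightarrow> (nat \<Rightarrow> real) \<Rightarrow> (nat \<Rightarrow> real) \<Rightarrow>
   (real \<Rightarrow> real) \<Rightarrow> (nat \<Rightarrow> real) \<Rightarrow> bool" where
  "is_lp_solution p \<tau> \<sigma> a b q r f x \<longleftrightarrow> is_solution \<tau> \<sigma> a b q r f x \<and> in_lp p x"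

end

theory Submission
  imports Defs
begin

text \<open>
  Write \<open>S g n = (\<Sum>s\<ge>n. (\<Sum>t\<ge>s. g t) / r s)\<close>. Whenever these series converge absolutely,
  \<open>\<Delta> (r * \<Delta> (S g)) = g\<close>, so a sequence with
  \<open>x n + q n * x (n - \<tau>) = S (\<lambda>t. a t * f (x (t - \<sigma>)) + b t) n\<close> for all \<open>n \<ge> k\<close> solves the equation
  from \<open>k\<close> on. Choosing \<open>x n = 0\<close> for \<open>n < k\<close> turns this into a fixed point problem.

  \<^emph>\<open>Existence.\<close> The fixed point is found by Banach's theorem in the sup norm, on the sequences with
  values in \<open>[-1,1]\<close>. On this compact interval \<open>f\<close> is bounded and Lipschitz. The delayed term
  contracts by the factor \<open>q\<^sup>\<star> < 1\<close>, and since the double tails of \<open>a\<close> and \<open>b\<close> tend to zero, a large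
  \<open>k\<close> makes the contribution of \<open>S\<close> as small as desired. Working in the sup norm, rather than in
  \<open>l\<^sup>p\<close>, makes it irrelevant whether \<open>t - \<sigma>\<close> lies to the left or to the right of \<open>t\<close>.

  \<^emph>\<open>Summability.\<close> The fixed point satisfies \<open>\<bar>x n\<bar> \<le> q\<^sup>\<star> * \<bar>x (n - \<tau>)\<bar> + C n\<close>, where \<open>C\<close> is a
  combination of the double tails of \<open>\<bar>a\<bar>\<close> and \<open>\<bar>b\<bar>\<close> and hence in \<open>l\<^sup>p\<close>. By convexity of the \<open>p\<close>-th
  power, \<open>\<bar>x n\<bar>\<^sup>p \<le> \<theta> * \<bar>x (n - \<tau>)\<bar>\<^sup>p + 2\<^bsup>p-1\<^esup> * C n\<^sup>p\<close> with \<open>\<theta> = 2\<^bsup>p-1\<^esup> * q\<^sup>\<star>\<^sup>p < 1\<close>, and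
  summing over \<open>n\<close> bounds the partial sums of \<open>\<bar>x n\<bar>\<^sup>p\<close>.
\<close>

section \<open>Tails and iterated tails of real series\<close>

definition tail_sum :: "(nat \<Rightarrow> real) \<Rightarrow> nat \<Rightarrow> real" where
  "tail_sum g n = (\<Sum>i. g (i + n))"

definition double_tail :: "(nat \<Rightarrow> real) \<Rightarrow> (nat \<Rightarrow> real) \<Rightarrow> nat \<Rightarrow> real" where
  "double_tail r g = tail_sum (\<lambda>s. tail_sum g s / r s)"

abbreviation abs_double_tail :: "(nat \<Rightarrow> real) \<Rightarrow> (nat \<Rightarrow> real) \<Rightarrow> nat \<Rightarrow> real" where
  "abs_double_tail r g \<equiv> double_tail (\<lambda>s. \<bar>r s\<bar>) (\<lambda>t. \<bar>g t\<bar>)"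

definition abs_double_summable :: "(nat \<Rightarrow> real) \<Rightarrow> (nat \<Rightarrow> real) \<Rightarrow> bool" where
  "abs_double_summable r g \<longleftrightarrow>
     summable (\<lambda>t. \<bar>g t\<bar>) \<and> summable (\<lambda>s. tail_sum (\<lambda>t. \<bar>g t\<bar>) s / \<bar>r s\<bar>)"

lemma tail_sum_Suc: "tail_sum g (Suc n) = tail_sum g n - g n" if "summable g"
  using suminf_split_head[of "\<lambda>i. g (i + n)"] that by (simp add: tail_sum_def)

lemma tail_sum_lincomb:
  assumes "summable g" "summable h"
  shows "tail_sum (\<lambda>t. c * g t + d * h t) n = c * tail_sum g n + d * tail_sum h n"
proof -
  have "summable (\<lambda>i. g (i + n))" "summable (\<lambda>i. h (i + n))"
    using assms by (simp_all only: summable_iff_shift)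
  then show ?thesis
    unfolding tail_sum_def by (simp add: suminf_add[symmetric] suminf_mult summable_mult)
qed

lemma tail_sum_mono:
  assumes "summable g" "summable h" "\<And>t. g t \<le> h t"
  shows "tail_sum g n \<le> tail_sum h n"
  unfolding tail_sum_def using assms by (intro suminf_le) auto

lemma tail_sum_nonneg: "0 \<le> tail_sum g n" if "summable g" "\<And>t. 0 \<le> g t"
  unfolding tail_sum_def using that by (intro suminf_nonneg) auto

lemma abs_tail_sum_le: "\<bar>tail_sum g n\<bar> \<le> tail_sum (\<lambda>t. \<bar>g t\<bar>) n" if "summable (\<lambda>t. \<bar>g t\<bar>)"
  unfolding tail_sum_def by (intro summable_rabs summable_ignore_initial_segment[OF that])

lemma tail_sum_eventually_small:
  assumes "summable g" "0 < e"
  shows "\<exists>N. \<forall>n\<ge>N. \<bar>tail_sum g n\<bar> < e"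
  using suminf_exist_split[OF assms(2,1)] by (simp add: tail_sum_def)

lemma abs_double_summableD:
  assumes "abs_double_summable r g"
  shows "summable g" "summable (\<lambda>s. \<bar>tail_sum g s / r s\<bar>)" "summable (\<lambda>s. tail_sum g s / r s)"
proof -
  show "summable g"
    using assms by (auto simp: abs_double_summable_def intro: summable_rabs_cancel)
  show "summable (\<lambda>s. \<bar>tail_sum g s / r s\<bar>)"
    by (rule summable_rabs_comparison_test[of _ "\<lambda>s. tail_sum (\<lambda>t. \<bar>g t\<bar>) s / \<bar>r s\<bar>"])
      (use assms in \<open>auto simp: abs_double_summable_def intro!: divide_right_mono abs_tail_sum_le\<close>)
  then show "summable (\<lambda>s. tail_sum g s / r s)"
    by (rule summable_rabs_cancel)
qed

lemma abs_double_tail_nonneg: "0 \<le> abs_double_tail r g n" if "abs_double_summable r g"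
  unfolding double_tail_def using that
  by (intro tail_sum_nonneg divide_nonneg_nonneg) (auto simp: abs_double_summable_def)

lemma double_tail_diff:
  assumes "abs_double_summable r g" "abs_double_summable r h"
  shows "double_tail r (\<lambda>t. g t - h t) n = double_tail r g n - double_tail r h n"
proof -
  have "tail_sum (\<lambda>t. g t - h t) s = tail_sum g s - tail_sum h s" for s
    using tail_sum_lincomb[of g h 1 "-1" s] assms by (simp add: abs_double_summableD)
  then show ?thesis
    using tail_sum_lincomb[of "\<lambda>s. tail_sum g s / r s" "\<lambda>s. tail_sum h s / r s" 1 "-1" n] assms
    by (simp add: double_tail_def abs_double_summableD diff_divide_distrib)
qed

text \<open>
  One estimate with two uses: for \<open>g t = a t * f (u (t - \<sigma>)) + b t\<close> it bounds the nonlinear term, and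
  with \<open>N = 0\<close>, for the difference of two such sequences, it gives the Lipschitz constant of this term.
\<close>

lemma double_tail_dominated:
  assumes a: "abs_double_summable r a" and b: "abs_double_summable r b"
    and dom: "\<And>t. \<bar>g t\<bar> \<le> M * \<bar>a t\<bar> + N * \<bar>b t\<bar>"
  shows "abs_double_summable r g"
    and "\<bar>double_tail r g n\<bar> \<le> M * abs_double_tail r a n + N * abs_double_tail r b n"
proof -
  let ?h = "\<lambda>t. M * \<bar>a t\<bar> + N * \<bar>b t\<bar>"
  let ?A = "\<lambda>s. tail_sum (\<lambda>t. \<bar>a t\<bar>) s / \<bar>r s\<bar>" and ?B = "\<lambda>s. tail_sum (\<lambda>t. \<bar>b t\<bar>) s / \<bar>r s\<bar>"
  have sm: "summable (\<lambda>t. \<bar>a t\<bar>)" "summable (\<lambda>t. \<bar>b t\<bar>)" "summable ?A" "summable ?B"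
    using a b by (auto simp: abs_double_summable_def)
  have sh: "summable ?h"
    using sm by (intro summable_add summable_mult)
  have sg: "summable (\<lambda>t. \<bar>g t\<bar>)"
    by (rule summable_rabs_comparison_test[OF _ sh]) (use dom in auto)
  have le: "tail_sum (\<lambda>t. \<bar>g t\<bar>) s / \<bar>r s\<bar> \<le> M * ?A s + N * ?B s" for s
  proof -
    have "tail_sum (\<lambda>t. \<bar>g t\<bar>) s \<le> tail_sum ?h s"
      by (intro tail_sum_mono sg sh dom)
    also have "\<dots> = M * tail_sum (\<lambda>t. \<bar>a t\<bar>) s + N * tail_sum (\<lambda>t. \<bar>b t\<bar>) s"
      using sm by (intro tail_sum_lincomb)
    finally show ?thesis
      by (simp add: divide_right_mono flip: add_divide_distrib)
  qed
  have sAB: "summable (\<lambda>s. M * ?A s + N * ?B s)"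
    using sm by (intro summable_add summable_mult)
  have "summable (\<lambda>s. tail_sum (\<lambda>t. \<bar>g t\<bar>) s / \<bar>r s\<bar>)"
    by (rule summable_comparison_test'[OF sAB, of 0]) (use le tail_sum_nonneg[OF sg] in auto)
  then show g: "abs_double_summable r g"
    using sg by (simp add: abs_double_summable_def)
  have "\<bar>double_tail r g n\<bar> \<le> tail_sum (\<lambda>s. \<bar>tail_sum g s / r s\<bar>) n"
    unfolding double_tail_def by (intro abs_tail_sum_le abs_double_summableD[OF g])
  also have "\<dots> \<le> tail_sum (\<lambda>s. M * ?A s + N * ?B s) n"
  proof (rule tail_sum_mono[OF abs_double_summableD(2)[OF g] sAB])
    fix s
    have "\<bar>tail_sum g s / r s\<bar> \<le> tail_sum (\<lambda>t. \<bar>g t\<bar>) s / \<bar>r s\<bar>"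
      by (auto intro!: divide_right_mono abs_tail_sum_le[OF sg])
    with le[of s] show "\<bar>tail_sum g s / r s\<bar> \<le> M * ?A s + N * ?B s"
      by linarith
  qed
  also have "\<dots> = M * abs_double_tail r a n + N * abs_double_tail r b n"
    unfolding double_tail_def using sm by (intro tail_sum_lincomb)
  finally show "\<bar>double_tail r g n\<bar> \<le> M * abs_double_tail r a n + N * abs_double_tail r b n" .
qed

text \<open>
  The iterated tail inverts the second order difference operator. Two differences remove the two
  summations, and the two minus signs they produce cancel.
\<close>

lemma diff_r_diff_double_tail:
  assumes g: "abs_double_summable r g" and y: "\<And>m. m \<ge> n \<Longrightarrow> y m = double_tail r g m"
    and r: "\<And>m. m \<ge> n \<Longrightarrow> r m \<noteq> 0"
  shows "\<Delta> (\<lambda>m. r m * \<Delta> y m) n = g n"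
proof -
  have "r m * \<Delta> y m = - tail_sum g m" if "m \<ge> n" for m
    using that r[OF that] y[of m] y[of "Suc m"] abs_double_summableD(3)[OF g]
    by (simp add: forward_diff_def double_tail_def tail_sum_Suc)
  then show ?thesis
    using abs_double_summableD(1)[OF g] by (simp add: forward_diff_def tail_sum_Suc)
qed

section \<open>The summability hypothesis in terms of real series\<close>

lemma infsum_ennreal_atLeast:
  fixes g :: "nat \<Rightarrow> ennreal"
  shows "infsum g {n..} = (\<Sum>i. g (i + n))"
proof -
  have "bij_betw (\<lambda>i. i + n) UNIV {n..}"
    by (rule bij_betw_byWitness[where f' = "\<lambda>i. i - n"]) auto
  from has_sum_reindex_bij_betw[OF this, of g] have "((\<lambda>i. g (i + n)) has_sum infsum g {n..}) UNIV"
    using has_sum_infsum[OF nonneg_summable_on_complete, of "{n..}" g] by simp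
  from has_sum_imp_sums[OF this] show ?thesis
    by (rule sums_unique)
qed

lemma infsum_abs_atLeast_finite:
  fixes g :: "nat \<Rightarrow> real"
  assumes "(\<Sum>\<^sub>\<infinity>s\<in>{n..}. ennreal \<bar>g s\<bar>) \<noteq> \<infinity>"
  shows "summable (\<lambda>s. \<bar>g s\<bar>)"
proof -
  have "summable (\<lambda>i. \<bar>g (i + n)\<bar>)"
    using assms unfolding infsum_ennreal_atLeast by (intro summable_suminf_not_top) auto
  from summable_iff_shift[THEN iffD1, OF this] show ?thesis .
qed

lemma infsum_abs_atLeast_eq:
  fixes g :: "nat \<Rightarrow> real"
  assumes "summable (\<lambda>s. \<bar>g s\<bar>)"
  shows "(\<Sum>\<^sub>\<infinity>s\<in>{n..}. ennreal \<bar>g s\<bar>) = ennreal (tail_sum (\<lambda>s. \<bar>g s\<bar>) n)"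
  unfolding infsum_ennreal_atLeast tail_sum_def
  by (rule suminf_ennreal2[OF _ summable_ignore_initial_segment[OF assms]]) auto

lemma infsum_ennreal_finite_elem:
  fixes g :: "nat \<Rightarrow> ennreal"
  assumes "infsum g {n..} \<noteq> \<infinity>" "s \<ge> n"
  shows "g s \<noteq> \<infinity>"
proof
  assume "g s = \<infinity>"
  have "g s = infsum g {s}" by simp
  also have "\<dots> \<le> infsum g {n..}"
    using assms(2) by (intro infsum_mono_neutral nonneg_summable_on_complete) auto
  finally show False
    using assms(1) \<open>g s = \<infinity>\<close> by (simp add: top_unique)
qed

text \<open>
  Finiteness passes from the outer sum to the inner ones because \<open>\<infinity>\<close> survives every step outwards:
  the power preserves it, and so does the factor \<open>\<bar>1 / r s\<bar>\<close>, which is not zero.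
\<close>

lemma iterated_tail_sum_finiteD:
  assumes r: "\<And>n. n \<ge> 1 \<Longrightarrow> r n \<noteq> 0" and fin: "iterated_tail_sum p r c < \<infinity>"
  shows "abs_double_summable r c" and "summable (\<lambda>n. abs_double_tail r c n powr p)"
proof -
  let ?T = "\<lambda>s. \<Sum>\<^sub>\<infinity>t\<in>{s..}. ennreal \<bar>c t\<bar>"
  let ?D = "\<lambda>n. \<Sum>\<^sub>\<infinity>s\<in>{n..}. ennreal \<bar>1 / r s\<bar> * ?T s"
  let ?u = "\<lambda>s. tail_sum (\<lambda>t. \<bar>c t\<bar>) s / r s"
  have D: "(\<Sum>\<^sub>\<infinity>n\<in>{1..}. ennreal_powr (?D n) p) \<noteq> \<infinity>"
    using fin by (simp add: iterated_tail_sum_def)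
  have D1: "?D 1 \<noteq> \<infinity>"
    using infsum_ennreal_finite_elem[OF D, of 1] by (auto simp: ennreal_powr_def)
  have "ennreal \<bar>1 / r 1\<bar> * ?T 1 \<noteq> \<infinity>"
    by (rule infsum_ennreal_finite_elem[OF D1]) simp
  then have "?T 1 \<noteq> \<infinity>"
    using r[of 1] by (auto simp: ennreal_mult_top)
  then have c: "summable (\<lambda>t. \<bar>c t\<bar>)"
    by (rule infsum_abs_atLeast_finite)
  have pos: "0 \<le> tail_sum (\<lambda>t. \<bar>c t\<bar>) s" for s
    by (intro tail_sum_nonneg c) auto
  have u: "ennreal \<bar>1 / r s\<bar> * ?T s = ennreal \<bar>?u s\<bar>" for s
    using pos[of s] by (simp add: infsum_abs_atLeast_eq[OF c] flip: ennreal_mult)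
  have absu: "\<bar>?u s\<bar> = tail_sum (\<lambda>t. \<bar>c t\<bar>) s / \<bar>r s\<bar>" for s
    using pos[of s] by simp
  have su: "summable (\<lambda>s. \<bar>?u s\<bar>)"
    using D1 unfolding u by (rule infsum_abs_atLeast_finite)
  then show ds: "abs_double_summable r c"
    using c unfolding absu by (simp add: abs_double_summable_def)
  have "?D n = ennreal (abs_double_tail r c n)" for n
    unfolding u infsum_abs_atLeast_eq[OF su] by (simp only: absu double_tail_def)
  then have "ennreal_powr (?D n) p = ennreal \<bar>abs_double_tail r c n powr p\<bar>" for n
    using abs_double_tail_nonneg[OF ds, of n] by (simp add: ennreal_powr_def)
  with D have "summable (\<lambda>n. \<bar>abs_double_tail r c n powr p\<bar>)"
    by (intro infsum_abs_atLeast_finite[where n = 1]) simp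
  then show "summable (\<lambda>n. abs_double_tail r c n powr p)"
    by simp
qed

section \<open>Locally Lipschitz functions on compact intervals\<close>

lemma locally_lipschitz_on_compact:
  assumes "locally_lipschitz f" "compact X"
  obtains L where "0 \<le> L" "L-lipschitz_on X f"
proof -
  have "local_lipschitz (UNIV :: real set) UNIV (\<lambda>_. f)"
    using assms(1) by (simp add: locally_lipschitz_iff_local_lipschitz)
  then have "local_lipschitz {0 :: real} X (\<lambda>_. f)"
    by (rule local_lipschitz_subset) auto
  then obtain L where "L-lipschitz_on X f"
    by (rule local_lipschitz_compact_implies_lipschitz) (use assms(2) that in auto)
  then show thesis
    using that lipschitz_on_nonneg by blast
qed

section \<open>Contractions of bounded sequences\<close>

text \<open>
  Uniform Cauchy sequences converge uniformly, and uniform limits of bounded continuous functions are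
  bounded and continuous. Only the topology of the domain enters, so this covers functions on \<open>nat\<close>.
\<close>

lemma complete_UNIV_bcontfun:
  "complete (UNIV :: ('a :: topological_space \<Rightarrow>\<^sub>C 'b :: complete_space) set)"
proof (rule completeI)
  fix F :: "nat \<Rightarrow> 'a \<Rightarrow>\<^sub>C 'b"
  assume "Cauchy F"
  have "\<forall>e>0. \<exists>N. \<forall>m n x. N \<le> m \<and> N \<le> n \<and> True \<longrightarrow> dist (F m x) (F n x) < e"
  proof (intro allI impI)
    fix e :: real assume "e > 0"
    with \<open>Cauchy F\<close> obtain N where "\<And>m n. N \<le> m \<Longrightarrow> N \<le> n \<Longrightarrow> dist (F m) (F n) < e"
      unfolding Cauchy_def by blast
    then show "\<exists>N. \<forall>m n x. N \<le> m \<and> N \<le> n \<and> True \<longrightarrow> dist (F m x) (F n x) < e"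
      by (intro exI[of _ N] allI impI dist_fun_lt_imp_dist_val_lt) simp
  qed
  from uniformly_convergent_eq_cauchy[THEN iffD2, OF this]
  obtain g where g: "\<forall>e>0. \<exists>N. \<forall>n x. N \<le> n \<and> True \<longrightarrow> dist (F n x) (g x) < e"
    by (rule exE)
  have "uniform_limit UNIV (\<lambda>i. apply_bcontfun (F i)) g sequentially"
    unfolding uniform_limit_sequentially_iff using g by simp
  then obtain l where "F \<longlonglongrightarrow> l"
    by (rule uniform_limit_bcontfunE) simp
  then show "\<exists>l\<in>UNIV. F \<longlonglongrightarrow> l"
    by (intro bexI[of _ l]) auto
qed

text \<open>
  Banach's fixed point theorem on the closed unit ball of \<open>l\<^sup>\<infinity>\<close>, which is realised as the space of
  bounded continuous functions on the discrete space \<open>nat\<close>.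
\<close>

lemma sup_contraction_fixpoint:
  fixes \<Phi> :: "(nat \<Rightarrow> real) \<Rightarrow> nat \<Rightarrow> real"
  assumes \<theta>: "0 \<le> \<theta>" "\<theta> < 1"
    and self: "\<And>u n. (\<And>m. \<bar>u m\<bar> \<le> 1) \<Longrightarrow> \<bar>\<Phi> u n\<bar> \<le> 1"
    and contr: "\<And>u v d n. \<lbrakk>\<And>m. \<bar>u m\<bar> \<le> 1; \<And>m. \<bar>v m\<bar> \<le> 1; \<And>m. \<bar>u m - v m\<bar> \<le> d\<rbrakk>
      \<Longrightarrow> \<bar>\<Phi> u n - \<Phi> v n\<bar> \<le> \<theta> * d"
  obtains u where "\<And>n. \<bar>u n\<bar> \<le> 1" "\<And>n. \<Phi> u n = u n"
proof -
  let ?B = "cball 0 1 :: (nat \<Rightarrow>\<^sub>C real) set"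
  define F :: "(nat \<Rightarrow>\<^sub>C real) \<Rightarrow> (nat \<Rightarrow>\<^sub>C real)" where "F u = Bcontfun (\<Phi> u)" for u
  have bd: "\<bar>apply_bcontfun u m\<bar> \<le> 1" if "u \<in> ?B" for u m
    using norm_bounded[of u m] that by simp
  have F: "apply_bcontfun (F u) = \<Phi> u" if "u \<in> ?B" for u
    unfolding F_def
    by (rule Bcontfun_inverse, rule bcontfun_normI[where b = 1]) (use self bd[OF that] in auto)
  have "\<exists>!u. u \<in> ?B \<and> F u = u"
  proof (rule Banach_fix[OF _ _ \<theta>])
    show "complete ?B"
      by (rule complete_closed_subset[OF closed_cball subset_UNIV complete_UNIV_bcontfun])
    show "F ` ?B \<subseteq> ?B"
      using self bd F by (auto intro!: norm_bound)
    show "dist (F u) (F v) \<le> \<theta> * dist u v" if "u \<in> ?B" "v \<in> ?B" for u v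
    proof (rule dist_bound)
      fix n
      show "dist (F u n) (F v n) \<le> \<theta> * dist u v"
        unfolding F[OF that(1)] F[OF that(2)] dist_real_def
        by (rule contr) (use bd that dist_bounded[of u _ v] in \<open>auto simp: dist_real_def\<close>)
    qed
  qed auto
  then obtain u where "u \<in> ?B" "F u = u"
    by blast
  with F[of u] bd[of u] show thesis
    by (intro that[of "apply_bcontfun u"]) auto
qed

section \<open>Summability from a delayed inequality\<close>

lemma powr_add_le:
  fixes x y p :: real
  assumes "p \<ge> 1" "0 \<le> x" "0 \<le> y"
  shows "(x + y) powr p \<le> 2 powr (p - 1) * (x powr p + y powr p)"
proof (cases "x = 0 \<or> y = 0")
  case True
  have "1 \<le> 2 powr (p - 1)"
    using assms by (intro ge_one_powr_ge_zero) auto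
  then have "1 * z powr p \<le> 2 powr (p - 1) * z powr p" for z :: real
    by (intro mult_right_mono) auto
  with True show ?thesis
    using assms by auto
next
  case False
  have "((1 - 1/2) *\<^sub>R x + (1/2) *\<^sub>R y) powr p \<le> (1 - 1/2) * x powr p + (1/2) * y powr p"
    by (rule convex_onD[OF powr_convex[OF assms(1)]]) (use False assms in auto)
  then have half: "((x + y) / 2) powr p \<le> (x powr p + y powr p) / 2"
    by (simp add: add_divide_distrib)
  have "(x + y) powr p = 2 powr p * ((x + y) / 2) powr p"
    using assms by (simp add: powr_divide)
  also have "\<dots> \<le> 2 powr p * ((x powr p + y powr p) / 2)"
    by (intro mult_left_mono half) auto
  also have "\<dots> = 2 powr (p - 1) * (x powr p + y powr p)"
    by (simp add: powr_diff)
  finally show ?thesis .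
qed

text \<open>
  Shifting the index does not increase partial sums, so the inequality, summed up, bounds each
  partial sum by \<open>\<theta>\<close> times itself plus a constant.
\<close>

lemma summable_if_delayed_le:
  fixes z D :: "nat \<Rightarrow> real"
  assumes \<theta>: "0 \<le> \<theta>" "\<theta> < 1" and z: "\<And>n. 0 \<le> z n" and D: "\<And>n. 0 \<le> D n" "summable D"
    and "\<tau> \<le> k" and le: "\<And>n. n \<ge> k \<Longrightarrow> z n \<le> \<theta> * z (n - \<tau>) + D n"
  shows "summable z"
proof (rule summableI_nonneg_bounded[OF z])
  fix N
  let ?S = "sum z {..<N}"
  have "?S \<le> sum z {..<k} + sum z {k..<N}"
    by (subst sum.union_disjoint[symmetric]) (auto intro!: sum_mono2 z)
  also have "sum z {k..<N} \<le> (\<Sum>n\<in>{k..<N}. \<theta> * z (n - \<tau>) + D n)"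
    by (intro sum_mono le) auto
  also have "\<dots> = \<theta> * (\<Sum>n\<in>{k..<N}. z (n - \<tau>)) + sum D {k..<N}"
    by (simp add: sum.distrib sum_distrib_left)
  also have "(\<Sum>n\<in>{k..<N}. z (n - \<tau>)) = sum z ((\<lambda>n. n - \<tau>) ` {k..<N})"
    by (subst sum.reindex) (use \<open>\<tau> \<le> k\<close> in \<open>auto simp: inj_on_def\<close>)
  also have "\<theta> * \<dots> \<le> \<theta> * ?S"
    by (intro mult_left_mono sum_mono2 z \<theta>) auto
  also have "sum D {k..<N} \<le> suminf D"
    using D by (intro sum_le_suminf) auto
  finally have "?S \<le> sum z {..<k} + (\<theta> * ?S + suminf D)"
    by simp
  then show "?S \<le> (sum z {..<k} + suminf D) / (1 - \<theta>)"
    using \<theta> by (simp add: field_simps)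
qed

lemma in_lp_if_delayed_le:
  assumes p: "p \<ge> 1" and c: "0 < c" "c < 2 powr (1 - p)"
    and C: "\<And>n. 0 \<le> C n" "summable (\<lambda>n. C n powr p)"
    and "\<tau> \<le> k" and le: "\<And>n. n \<ge> k \<Longrightarrow> \<bar>x n\<bar> \<le> c * \<bar>x (n - \<tau>)\<bar> + C n"
  shows "in_lp p x"
  unfolding in_lp_def
proof (rule summable_if_delayed_le[where \<theta> = "2 powr (p - 1) * c powr p"
      and D = "\<lambda>n. 2 powr (p - 1) * C n powr p", OF _ _ _ _ _ \<open>\<tau> \<le> k\<close>])
  have "2 powr (1 - p) \<le> (1 :: real)"
    using powr_mono[of "1 - p" 0 "2 :: real"] p by simp
  then have "c powr p \<le> c powr 1"
    using c p by (intro powr_mono') auto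
  then have "2 powr (p - 1) * c powr p \<le> 2 powr (p - 1) * c"
    using c by simp
  also have "\<dots> < 2 powr (p - 1) * 2 powr (1 - p)"
    using c by simp
  also have "\<dots> = 1"
    by (simp flip: powr_add)
  finally show "2 powr (p - 1) * c powr p < 1" .
next
  fix n assume "n \<ge> k"
  then have "\<bar>x n\<bar> powr p \<le> (c * \<bar>x (n - \<tau>)\<bar> + C n) powr p"
    using le p by (intro powr_mono2) auto
  also have "\<dots> \<le> 2 powr (p - 1) * ((c * \<bar>x (n - \<tau>)\<bar>) powr p + C n powr p)"
    using p c C by (intro powr_add_le) auto
  also have "\<dots> = 2 powr (p - 1) * c powr p * \<bar>x (n - \<tau>)\<bar> powr p + 2 powr (p - 1) * C n powr p"
    using c by (simp add: powr_mult algebra_simps)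
  finally show "\<bar>x n\<bar> powr p \<le> \<dots>" .
qed (use C in \<open>auto intro: summable_mult\<close>)

lemma summable_powr_lincomb:
  fixes A B :: "nat \<Rightarrow> real" and M p :: real
  assumes p: "p \<ge> 1" and "0 \<le> M" and A: "\<And>n. 0 \<le> A n" "summable (\<lambda>n. A n powr p)"
    and B: "\<And>n. 0 \<le> B n" "summable (\<lambda>n. B n powr p)"
  shows "summable (\<lambda>n. (M * A n + B n) powr p)"
proof (rule summable_comparison_test'[where N = 0])
  show "summable (\<lambda>n. 2 powr (p - 1) * (M powr p * A n powr p + B n powr p))"
    using A B by (intro summable_mult summable_add)
  show "norm ((M * A n + B n) powr p) \<le> 2 powr (p - 1) * (M powr p * A n powr p + B n powr p)" for n
    using powr_add_le[OF p, of "M * A n" "B n"] A B \<open>0 \<le> M\<close> by (simp add: powr_mult)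
qed

section \<open>Existence of an \<open>l\<^sup>p\<close>-solution\<close>

theorem theorem9:
  fixes \<tau> :: nat and \<sigma> :: int
    and a b q r :: "nat \<Rightarrow> real" and f :: "real \<Rightarrow> real" and p qstar :: real
  assumes "\<And>n. n \<ge> 1 \<Longrightarrow> r n \<noteq> 0"
    and "p \<ge> 1"
    and "locally_lipschitz f"
    and "iterated_tail_sum p r a < \<infinity>"
    and "iterated_tail_sum p r b < \<infinity>"
    and "bdd_above ((\<lambda>n. \<bar>q n\<bar>) ` {1..})"
    and "(SUP n\<in>{1..}. \<bar>q n\<bar>) = qstar"
    and "0 < qstar" and "qstar < 2 powr (1 - p)"
  shows "\<exists>x. is_lp_solution p \<tau> \<sigma> a b q r f x"
proof -
  note r = assms(1) and p = assms(2) and qpos = assms(8) and qless = assms(9)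
  have q: "\<bar>q n\<bar> \<le> qstar" if "n \<ge> 1" for n
    using cSUP_upper[OF _ assms(6), of n] that assms(7) by simp
  have "2 powr (1 - p) \<le> (1 :: real)"
    using powr_mono[of "1 - p" 0 "2 :: real"] p by simp
  with qless have q1: "qstar < 1" by linarith
  note a = iterated_tail_sum_finiteD[OF r assms(4)] and b = iterated_tail_sum_finiteD[OF r assms(5)]
  let ?A = "abs_double_tail r a" and ?B = "abs_double_tail r b"
  have A0: "0 \<le> ?A n" and B0: "0 \<le> ?B n" for n
    using abs_double_tail_nonneg a(1) b(1) by auto
  obtain L where L: "0 \<le> L" "L-lipschitz_on {-1..1} f"
    using locally_lipschitz_on_compact[OF assms(3), of "{-1..1}"] by auto
  have fL: "\<bar>f x - f y\<bar> \<le> L * \<bar>x - y\<bar>" if "\<bar>x\<bar> \<le> 1" "\<bar>y\<bar> \<le> 1" for x y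
    using lipschitz_onD[OF L(2), of x y] that by (auto simp: dist_real_def abs_le_iff)
  define M where "M = \<bar>f 0\<bar> + L"
  have M: "0 \<le> M" "\<bar>f x\<bar> \<le> M" if "\<bar>x\<bar> \<le> 1" for x
  proof -
    show "0 \<le> M" using L by (simp add: M_def)
    have "L * \<bar>x\<bar> \<le> L" using L that by (simp add: mult_left_le)
    with fL[of x 0] that show "\<bar>f x\<bar> \<le> M" by (simp add: M_def)
  qed
  have M0: "0 \<le> M" using M(1)[of 0] by simp

  \<comment> \<open>With this \<open>e\<close> both \<open>qstar + M * e + e \<le> 1\<close> (the unit ball is mapped to itself) and
    \<open>qstar + L * e < 1\<close> (the map contracts) hold.\<close>
  define e where "e = (1 - qstar) / (M + L + 2)"
  have e: "0 < e"
    using q1 M0 L by (simp add: e_def)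
  have "e * (M + L + 2) = 1 - qstar"
    using M0 L by (simp add: e_def)
  then have eq: "M * e + L * e + 2 * e = 1 - qstar"
    by (simp add: algebra_simps)
  have "\<exists>N. \<forall>n\<ge>N. abs_double_tail r c n < e" if "abs_double_summable r c" for c
  proof -
    have "\<exists>N. \<forall>n\<ge>N. \<bar>abs_double_tail r c n\<bar> < e"
      unfolding double_tail_def
      by (rule tail_sum_eventually_small[OF _ e]) (use that in \<open>simp add: abs_double_summable_def\<close>)
    then show ?thesis
      by (meson abs_less_iff)
  qed
  from this[OF a(1)] this[OF b(1)]
  obtain N1 N2 where N: "\<And>n. n \<ge> N1 \<Longrightarrow> ?A n < e" "\<And>n. n \<ge> N2 \<Longrightarrow> ?B n < e"
    by blast
  define k where "k = 1 + \<tau> + nat \<sigma> + N1 + N2"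
  have k: "k \<ge> 1" "k \<ge> \<tau>" "k \<ge> nat \<sigma>" "k \<ge> N1" "k \<ge> N2"
    by (auto simp: k_def)
  have small: "?A n \<le> e" "?B n \<le> e" if "n \<ge> k" for n
    using N(1)[of n] N(2)[of n] k that by auto

  \<comment> \<open>For \<open>t < \<sigma>\<close> the index is truncated to \<open>0\<close>. This is harmless: the values \<open>G u t\<close> that enter the
    fixed point equation have \<open>t \<ge> k \<ge> \<sigma>\<close>.\<close>
  define G where "G u t = a t * f (u (nat (int t - \<sigma>))) + b t" for u t
  have G: "abs_double_summable r (G u)"
      "\<bar>double_tail r (G u) n\<bar> \<le> M * ?A n + ?B n" if u: "\<And>m. \<bar>u m\<bar> \<le> 1" for u n
  proof -
    have "\<bar>G u t\<bar> \<le> M * \<bar>a t\<bar> + 1 * \<bar>b t\<bar>" for t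
    proof -
      have "\<bar>a t * f (u (nat (int t - \<sigma>)))\<bar> \<le> M * \<bar>a t\<bar>"
        using mult_right_mono[OF M(2)[OF u[of "nat (int t - \<sigma>)"]], of "\<bar>a t\<bar>"]
        by (simp add: abs_mult mult.commute)
      then show ?thesis
        unfolding G_def by linarith
    qed
    from double_tail_dominated[OF a(1) b(1) this]
    show "abs_double_summable r (G u)" "\<bar>double_tail r (G u) n\<bar> \<le> M * ?A n + ?B n"
      by simp_all
  qed
  have Gdiff: "\<bar>double_tail r (G u) n - double_tail r (G v) n\<bar> \<le> L * d * ?A n"
    if u: "\<And>m. \<bar>u m\<bar> \<le> 1" and v: "\<And>m. \<bar>v m\<bar> \<le> 1" and d: "\<And>m. \<bar>u m - v m\<bar> \<le> d" for u v d n
  proof -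
    have "\<bar>G u t - G v t\<bar> \<le> (L * d) * \<bar>a t\<bar> + 0 * \<bar>b t\<bar>" for t
    proof -
      let ?m = "nat (int t - \<sigma>)"
      have "\<bar>f (u ?m) - f (v ?m)\<bar> \<le> L * d"
        using fL[OF u[of ?m] v[of ?m]] mult_left_mono[OF d[of ?m] L(1)] by linarith
      from mult_left_mono[OF this, of "\<bar>a t\<bar>"] show ?thesis
        by (simp add: G_def mult.commute flip: abs_mult right_diff_distrib)
    qed
    from double_tail_dominated(2)[OF a(1) b(1) this, of n] show ?thesis
      by (simp add: double_tail_diff[OF G(1)[where u = u, OF u] G(1)[where u = v, OF v]])
  qed

  define \<Phi> where "\<Phi> u n = (if n < k then 0 else double_tail r (G u) n - q n * u (n - \<tau>))" for u n
  have delay: "\<bar>q n * x\<bar> \<le> qstar * \<bar>x\<bar>" if "n \<ge> k" for n x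
    using q[of n] that k by (auto simp: abs_mult intro!: mult_right_mono)
  obtain x where x1: "\<And>n. \<bar>x n\<bar> \<le> 1" and fix_x: "\<And>n. \<Phi> x n = x n"
  proof (rule sup_contraction_fixpoint[of "qstar + L * e" \<Phi>])
    show "0 \<le> qstar + L * e"
      using qpos L e by simp
    show "qstar + L * e < 1"
      using eq e mult_nonneg_nonneg[OF M0, of e] by linarith
  next
    fix u :: "nat \<Rightarrow> real" and n assume u: "\<And>m. \<bar>u m\<bar> \<le> 1"
    show "\<bar>\<Phi> u n\<bar> \<le> 1"
    proof (cases "n < k")
      case False
      then have n: "n \<ge> k" by simp
      have "qstar * \<bar>u (n - \<tau>)\<bar> \<le> qstar"
        using u[of "n - \<tau>"] qpos by (simp add: mult_left_le)
      then show ?thesis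
        using delay[OF n, of "u (n - \<tau>)"] G(2)[where u = u and n = n, OF u] eq e small[OF n]
          mult_left_mono[OF small(1)[OF n] M0] mult_nonneg_nonneg[OF L(1), of e] False
        by (simp add: \<Phi>_def)
    qed (simp add: \<Phi>_def)
  next
    fix u v :: "nat \<Rightarrow> real" and d n
    assume u: "\<And>m. \<bar>u m\<bar> \<le> 1" and v: "\<And>m. \<bar>v m\<bar> \<le> 1" and d: "\<And>m. \<bar>u m - v m\<bar> \<le> d"
    have d0: "0 \<le> d" using d[of 0] by simp
    show "\<bar>\<Phi> u n - \<Phi> v n\<bar> \<le> (qstar + L * e) * d"
    proof (cases "n < k")
      case True
      then show ?thesis
        using d0 qpos L e by (simp add: \<Phi>_def)
    next
      case False
      then have n: "n \<ge> k" by simp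
      have "\<bar>q n * (u (n - \<tau>) - v (n - \<tau>))\<bar> \<le> qstar * d"
        using delay[OF n] mult_left_mono[OF d[of "n - \<tau>"], of qstar] qpos
        by (meson less_imp_le order_trans)
      moreover have "\<bar>double_tail r (G u) n - double_tail r (G v) n\<bar> \<le> L * d * e"
        using Gdiff[where u = u and v = v and d = d and n = n, OF u v d] mult_left_mono[OF small(1)[OF n], of "L * d"] L d0 by simp
      moreover have "\<Phi> u n - \<Phi> v n = (double_tail r (G u) n - double_tail r (G v) n)
          - q n * (u (n - \<tau>) - v (n - \<tau>))"
        using False by (simp add: \<Phi>_def algebra_simps)
      ultimately show ?thesis
        by (simp add: algebra_simps)
    qed
  qed (rule that)
  have x: "x n + q n * x (n - \<tau>) = double_tail r (G x) n" if "n \<ge> k" for n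
    using fix_x[of n] that by (simp add: \<Phi>_def)

  have "is_solution \<tau> \<sigma> a b q r f x"
    unfolding is_solution_def
  proof (intro exI conjI allI impI)
    show "int k \<ge> Max {1, int \<tau>, \<sigma>}"
      using k by auto
    fix n assume "n \<ge> k"
    then have "\<Delta> (\<lambda>m. r m * \<Delta> (\<lambda>l. x l + q l * x (l - \<tau>)) m) n = G x n"
      using x r k by (intro diff_r_diff_double_tail G(1) x1) auto
    then show "\<Delta> (\<lambda>m. r m * \<Delta> (\<lambda>l. x l + q l * x (l - \<tau>)) m) n
        = a n * f (x (nat (int n - \<sigma>))) + b n"
      by (simp add: G_def)
  qed
  moreover have "in_lp p x"
  proof (rule in_lp_if_delayed_le[OF p qpos qless _ _ k(2)])
    show "summable (\<lambda>n. (M * ?A n + ?B n) powr p)"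
      by (intro summable_powr_lincomb p M0 A0 B0 a(2) b(2))
    show "\<bar>x n\<bar> \<le> qstar * \<bar>x (n - \<tau>)\<bar> + (M * ?A n + ?B n)" if "n \<ge> k" for n
      using x[OF that] delay[OF that, of "x (n - \<tau>)"] G(2)[where u = x and n = n, OF x1] by linarith
  qed (use M0 A0 B0 in auto)
  ultimately show ?thesis
    unfolding is_lp_solution_def by blast
qed

end
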